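(* Let $S$ be a numerical semigroup and let $g_1,g_2$ be positive integers such that $\frac{g_2}{2}<g_1<g_2$. Then the following conditions are equivalent. 1. $\mathrm{E}(S)=\{g_1,g_2\}$. 2. $S$ is a maximal element (with respect to the inclusion order) of the set $\mathcal{I}_\cap(g_1,g_2)=\big\{ S_1\cap S_2 \mid S_1\in\mathcal{I}(g_1),\; S_2\in\mathcal{I}(g_2) \text{ and } g_1\in S_2 \big\}$ and, in addition, $g_1$ belongs to every element of $\mathcal{I}(g_2)$ which contains $S$.
   Context: $\mathbb{N}$ denotes the set of non-negative integers. A numerical semigroup is a subset $S\subseteq\mathbb{N}$ that is closed under addition, contains $0$, and has finite complement $\mathbb{N}\setminus S$. The Frobenius number $\mathrm{F}(S)$ is the greatest integer not belonging to $S$. A numerical semigroup is irreducible if it cannot be expressed as the intersection of two numerical semigroups containing it properly. For a positive integer $F$, $\mathcal{I}(F)$ is the set of all irreducible numerical semigroups with Frobenius number $F$. The set of special gaps of $S$ is $$\mathrm{E}(S)=\{x\in\mathbb{N}\setminus S \mid 2x\in S \text{ and } x+s\in S \text{ for all } s\in S\setminus\{0\}\}.$$ *)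

theory Defs
  imports Complex_Main
begin

definition numerical_semigroup :: "nat set \<Rightarrow> bool" where
  "numerical_semigroup S \<longleftrightarrow>
     0 \<in> S \<and> (\<forall>x\<in>S. \<forall>y\<in>S. x + y \<in> S) \<and> finite (UNIV - S)"

text \<open>The greatest integer (not only natural number) outside of \<open>S\<close>; thus the value is \<open>-1\<close>
  for \<open>S = UNIV\<close>. For a numerical semigroup the greatest element always exists.\<close>

definition frobenius_number :: "nat set \<Rightarrow> int" where
  "frobenius_number S = (GREATEST z :: int. z \<notin> int ` S)"

definition irreducible_semigroup :: "nat set \<Rightarrow> bool" where
  "irreducible_semigroup S \<longleftrightarrow> numerical_semigroup S \<and>
     \<not> (\<exists>S1 S2. numerical_semigroup S1 \<and> numerical_semigroup S2 \<and>
           S \<subset> S1 \<and> S \<subset> S2 \<and> S = S1 \<inter> S2)"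

definition irreducibles_with_frobenius :: "nat \<Rightarrow> nat set set" where
  "irreducibles_with_frobenius F = {S. irreducible_semigroup S \<and> frobenius_number S = int F}"

definition special_gaps :: "nat set \<Rightarrow> nat set" where
  "special_gaps S = {x \<in> UNIV - S. 2 * x \<in> S \<and> (\<forall>s \<in> S - {0}. x + s \<in> S)}"

definition irreducible_intersections :: "nat \<Rightarrow> nat \<Rightarrow> nat set set" where
  "irreducible_intersections g1 g2 =
     {S1 \<inter> S2 | S1 S2. S1 \<in> irreducibles_with_frobenius g1 \<and>
        S2 \<in> irreducibles_with_frobenius g2 \<and> g1 \<in> S2}"

end

theory Submission
  imports Defs
begin

text \<open>
  The special gaps of a numerical semigroup \<open>S\<close> are exactly the gaps that can be added to \<open>S\<close>
  one at a time (\<open>numerical_semigroup_insert_special_gap\<close>), and every numerical semigroup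
  strictly above \<open>S\<close> contains one of them, namely the largest of its new elements
  (\<open>special_gap_in_strict_superset\<close>). Two consequences carry the proof: the irreducible
  semigroups with Frobenius number \<open>F\<close> are those whose only special gap is \<open>F\<close>
  (\<open>irreducibles_with_frobenius_iff\<close>), and every numerical semigroup avoiding \<open>F\<close> lies in one
  of these (\<open>ex_irreducible_superset\<close>), since an oversemigroup that is maximal among those
  avoiding \<open>F\<close> can have no other special gap.

  If the special gaps of \<open>S\<close> are \<open>g1\<close> and \<open>g2\<close>, then a numerical semigroup containing \<open>S\<close> and
  avoiding both equals \<open>S\<close>. Intersecting an irreducible semigroup above \<open>S \<union> {g2}\<close> with
  Frobenius number \<open>g1\<close> and one above \<open>S \<union> {g1}\<close> with Frobenius number \<open>g2\<close> therefore gives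
  \<open>S\<close>, and both maximality and the condition on \<open>g1\<close> follow.

  Conversely, if \<open>S = S1 \<inter> S2\<close> as in the definition of \<open>irreducible_intersections\<close>, then \<open>g2\<close> is
  the largest gap of \<open>S\<close>, hence special. So is \<open>g1\<close>: the double \<open>2 * g1\<close> exceeds \<open>g2\<close>, and for
  nonzero \<open>s \<in> S\<close> the sum \<open>g1 + s\<close> lies in \<open>S1\<close> because it exceeds \<open>g1\<close>, and in \<open>S2\<close> because
  \<open>g1\<close> and \<open>s\<close> do. A third
  special gap \<open>x\<close> would allow \<open>S \<union> {x}\<close> to be extended to irreducible semigroups with Frobenius
  numbers \<open>g1\<close> and \<open>g2\<close>; the second of them contains \<open>g1\<close> by hypothesis, so their
  intersection contradicts the maximality of \<open>S\<close>.
\<close>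

lemma numerical_semigroup_Int:
  assumes "numerical_semigroup S" and "numerical_semigroup T"
  shows "numerical_semigroup (S \<inter> T)"
  using assms unfolding numerical_semigroup_def by (auto simp: Diff_Int)

lemma numerical_semigroup_insert_special_gap:
  assumes S: "numerical_semigroup S" and x: "x \<in> special_gaps S"
  shows "numerical_semigroup (insert x S)"
proof -
  have xs: "x + s \<in> insert x S" if "s \<in> S" for s
    using that x by (cases "s = 0") (auto simp: special_gaps_def)
  have "a + b \<in> insert x S" if "a \<in> insert x S" "b \<in> insert x S" for a b
    using that xs[of a] xs[of b] x S
    by (auto simp: special_gaps_def numerical_semigroup_def mult_2 add.commute)
  moreover have "0 \<in> S" "finite (UNIV - S)"
    using S by (auto simp: numerical_semigroup_def)
  ultimately show ?thesis
    unfolding numerical_semigroup_def by (auto intro: finite_subset)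
qed

lemma special_gap_in_strict_superset:
  assumes S: "numerical_semigroup S" and T: "numerical_semigroup T" and "S \<subset> T"
  shows "\<exists>x\<in>T. x \<in> special_gaps S"
proof -
  define x where "x = Max (T - S)"
  have fin: "finite (T - S)"
    using S by (auto simp: numerical_semigroup_def intro: finite_subset[of _ "UNIV - S"])
  have x: "x \<in> T" "x \<notin> S"
    using Max_in[OF fin] \<open>S \<subset> T\<close> unfolding x_def by auto
  have above: "y \<in> S" if "y \<in> T" "x < y" for y
    using Max_ge[OF fin, of y] that unfolding x_def by fastforce
  have "x \<noteq> 0"
    using S x unfolding numerical_semigroup_def by metis
  moreover have "2 * x \<in> T"
    using T x by (simp add: numerical_semigroup_def mult_2)
  ultimately have "2 * x \<in> S"
    using above by simp
  moreover have "x + s \<in> S" if "s \<in> S - {0}" for s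
    using that T x \<open>S \<subset> T\<close> above[of "x + s"] by (auto simp: numerical_semigroup_def)
  ultimately have "x \<in> special_gaps S"
    using x by (simp add: special_gaps_def)
  then show ?thesis
    using x by blast
qed

lemma largest_gap_special:
  assumes S: "numerical_semigroup S" and m: "m \<notin> S" and above: "\<And>y. m < y \<Longrightarrow> y \<in> S"
  shows "m \<in> special_gaps S"
proof -
  have "m \<noteq> 0"
    using S m unfolding numerical_semigroup_def by metis
  then show ?thesis
    using m above by (auto simp: special_gaps_def)
qed

lemma frobenius_number_eq:
  assumes "m \<notin> S" and above: "\<And>y. m < y \<Longrightarrow> y \<in> S"
  shows "frobenius_number S = int m"
  unfolding frobenius_number_def
proof (rule Greatest_equality)
  fix z :: int
  assume z: "z \<notin> int ` S"
  show "z \<le> int m"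
  proof (rule ccontr)
    assume "\<not> z \<le> int m"
    then have "nat z \<in> S" "z = int (nat z)"
      using above[of "nat z"] by auto
    then show False
      using z by blast
  qed
qed (use assms in auto)

lemma obtain_largest_gap:
  assumes "numerical_semigroup S" and "S \<noteq> UNIV"
  obtains m where "m \<notin> S" and "\<And>y. m < y \<Longrightarrow> y \<in> S"
proof -
  have fin: "finite (UNIV - S)" and "UNIV - S \<noteq> {}"
    using assms by (auto simp: numerical_semigroup_def)
  then have "Max (UNIV - S) \<notin> S"
    using Max_in by blast
  moreover have "y \<in> S" if "Max (UNIV - S) < y" for y
    using Max_ge[OF fin, of y] that by fastforce
  ultimately show ?thesis
    using that by blast
qed

lemma frobenius_number_UNIV: "frobenius_number UNIV = -1"
  unfolding frobenius_number_def
proof (rule Greatest_equality)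
  fix z :: int
  assume "z \<notin> range int"
  then have "z < 0"
    by (metis nonneg_int_cases not_less rangeI)
  then show "z \<le> -1"
    by simp
qed auto

lemma frobenius_number_largest_gap:
  assumes "numerical_semigroup S" and F: "frobenius_number S = int F"
  shows "F \<notin> S" and "\<And>y. F < y \<Longrightarrow> y \<in> S"
proof -
  have "S \<noteq> UNIV"
    using F frobenius_number_UNIV by auto
  then obtain m where m: "m \<notin> S" "\<And>y. m < y \<Longrightarrow> y \<in> S"
    using obtain_largest_gap[OF assms(1)] by blast
  then have "m = F"
    using frobenius_number_eq[of m S] F by simp
  with m show "F \<notin> S" and "\<And>y. F < y \<Longrightarrow> y \<in> S"
    by auto
qed

lemma irreducibles_with_frobenius_iff:
  "S \<in> irreducibles_with_frobenius F \<longleftrightarrow> numerical_semigroup S \<and> special_gaps S = {F}"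
proof
  assume irr: "S \<in> irreducibles_with_frobenius F"
  then have S: "numerical_semigroup S" and fr: "frobenius_number S = int F"
    by (auto simp: irreducibles_with_frobenius_def irreducible_semigroup_def)
  have F: "F \<in> special_gaps S"
    using largest_gap_special[OF S] frobenius_number_largest_gap[OF S fr] by blast
  have "x = F" if x: "x \<in> special_gaps S" for x
  proof (rule ccontr)
    assume "x \<noteq> F"
    then have "S = insert x S \<inter> insert F S" "S \<subset> insert x S" "S \<subset> insert F S"
      using x F by (auto simp: special_gaps_def)
    moreover have "numerical_semigroup (insert x S)" "numerical_semigroup (insert F S)"
      using S x F by (auto intro: numerical_semigroup_insert_special_gap)
    ultimately have "\<not> irreducible_semigroup S"
      unfolding irreducible_semigroup_def by blast
    then show False
      using irr by (simp add: irreducibles_with_frobenius_def)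
  qed
  then have "special_gaps S = {F}"
    using F by blast
  with S show "numerical_semigroup S \<and> special_gaps S = {F}"
    by simp
next
  assume "numerical_semigroup S \<and> special_gaps S = {F}"
  then have S: "numerical_semigroup S" and E: "special_gaps S = {F}"
    by auto
  have F: "F \<notin> S"
    using E by (auto simp: special_gaps_def)
  then obtain m where m: "m \<notin> S" "\<And>y. m < y \<Longrightarrow> y \<in> S"
    using obtain_largest_gap[OF S] by blast
  have "m = F"
    using largest_gap_special[OF S m] E by simp
  then have "frobenius_number S = int F"
    using frobenius_number_eq[OF m] by simp
  moreover have "F \<in> T" if "numerical_semigroup T" "S \<subset> T" for T
    using special_gap_in_strict_superset[OF S that] E by simp
  then have "irreducible_semigroup S"
    using S F unfolding irreducible_semigroup_def by blast
  ultimately show "S \<in> irreducibles_with_frobenius F"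
    by (simp add: irreducibles_with_frobenius_def)
qed

lemma ex_irreducible_superset:
  assumes S: "numerical_semigroup S" and "F \<notin> S"
  shows "\<exists>T\<in>irreducibles_with_frobenius F. S \<subseteq> T"
proof -
  define \<A> where "\<A> = {T. numerical_semigroup T \<and> S \<subseteq> T \<and> F \<notin> T}"
  have "\<A> \<subseteq> (\<lambda>X. S \<union> X) ` Pow (UNIV - S)"
  proof
    fix T
    assume "T \<in> \<A>"
    then have "T = S \<union> (T - S)"
      by (auto simp: \<A>_def)
    then show "T \<in> (\<lambda>X. S \<union> X) ` Pow (UNIV - S)"
      by blast
  qed
  moreover have "finite (UNIV - S)"
    using S by (simp add: numerical_semigroup_def)
  ultimately have "finite \<A>"
    by (meson finite_Pow_iff finite_imageI finite_subset)
  moreover have "S \<in> \<A>"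
    using assms by (simp add: \<A>_def)
  ultimately obtain T where "T \<in> \<A>" and maximal: "\<And>U. U \<in> \<A> \<Longrightarrow> T \<subseteq> U \<Longrightarrow> T = U"
    using finite_has_maximal[of \<A>] by blast
  then have T: "numerical_semigroup T" "S \<subseteq> T" "F \<notin> T"
    by (auto simp: \<A>_def)
  have "x = F" if x: "x \<in> special_gaps T" for x
  proof (rule ccontr)
    assume "x \<noteq> F"
    then have "insert x T \<in> \<A>"
      using T numerical_semigroup_insert_special_gap[OF T(1) x] by (auto simp: \<A>_def)
    then have "x \<in> T"
      using maximal by blast
    then show False
      using x by (simp add: special_gaps_def)
  qed
  moreover have "special_gaps T \<noteq> {}"
    using obtain_largest_gap[OF T(1)] largest_gap_special[OF T(1)] T(3) by blast
  ultimately have "special_gaps T = {F}"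
    by auto
  then show ?thesis
    using T irreducibles_with_frobenius_iff by blast
qed

theorem theorem2p10:
  fixes S :: "nat set" and g1 g2 :: nat
  assumes "numerical_semigroup S"
    and "0 < g1" and "0 < g2"
    and "real g2 / 2 < real g1" and "g1 < g2"
  shows "special_gaps S = {g1, g2} \<longleftrightarrow>
    (S \<in> irreducible_intersections g1 g2 \<and>
     (\<forall>T \<in> irreducible_intersections g1 g2. S \<subseteq> T \<longrightarrow> T = S)) \<and>
    (\<forall>T \<in> irreducibles_with_frobenius g2. S \<subseteq> T \<longrightarrow> g1 \<in> T)"
    (is "?E \<longleftrightarrow> (?mem \<and> ?maximal) \<and> ?contain")
proof
  note S = assms(1)
  assume E: ?E
  then have gaps: "g1 \<notin> S" "g2 \<notin> S"
    by (auto simp: special_gaps_def)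
  have eq: "T = S" if "numerical_semigroup T" "S \<subseteq> T" "g1 \<notin> T" "g2 \<notin> T" for T
    using special_gap_in_strict_superset[OF S that(1)] that E by auto
  have avoid: "numerical_semigroup T" "F \<notin> T"
    if "T \<in> irreducibles_with_frobenius F" for T F
    using that by (auto simp: irreducibles_with_frobenius_iff special_gaps_def)
  have ins: "numerical_semigroup (insert g1 S)" "numerical_semigroup (insert g2 S)"
    using S E by (auto intro: numerical_semigroup_insert_special_gap)
  obtain S1 where S1: "S1 \<in> irreducibles_with_frobenius g1" "insert g2 S \<subseteq> S1"
    using ex_irreducible_superset[OF ins(2), of g1] gaps \<open>g1 < g2\<close> by auto
  obtain S2 where S2: "S2 \<in> irreducibles_with_frobenius g2" "insert g1 S \<subseteq> S2"
    using ex_irreducible_superset[OF ins(1), of g2] gaps \<open>g1 < g2\<close> by auto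
  have "S1 \<inter> S2 = S"
    using eq[OF numerical_semigroup_Int[OF avoid(1)[OF S1(1)] avoid(1)[OF S2(1)]]]
      S1 S2 avoid(2) by blast
  then have ?mem
    using S1 S2 unfolding irreducible_intersections_def by blast
  moreover have ?maximal
  proof (intro ballI impI)
    fix T
    assume "T \<in> irreducible_intersections g1 g2" and "S \<subseteq> T"
    then obtain T1 T2 where T: "T = T1 \<inter> T2" "T1 \<in> irreducibles_with_frobenius g1"
      "T2 \<in> irreducibles_with_frobenius g2"
      unfolding irreducible_intersections_def by blast
    then show "T = S"
      using eq[of T] \<open>S \<subseteq> T\<close> numerical_semigroup_Int[of T1 T2] avoid by blast
  qed
  moreover have ?contain
  proof (intro ballI impI, rule ccontr)
    fix T
    assume T: "T \<in> irreducibles_with_frobenius g2" and "S \<subseteq> T" and "g1 \<notin> T"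
    then have "T = S"
      using eq avoid by blast
    then have "special_gaps S = {g2}"
      using T irreducibles_with_frobenius_iff by blast
    then show False
      using E \<open>g1 < g2\<close> by auto
  qed
  ultimately show "(?mem \<and> ?maximal) \<and> ?contain"
    by blast
next
  note S = assms(1)
  assume asm: "(?mem \<and> ?maximal) \<and> ?contain"
  then obtain S1 S2 where eq: "S = S1 \<inter> S2" and S1: "S1 \<in> irreducibles_with_frobenius g1"
    and S2: "S2 \<in> irreducibles_with_frobenius g2" and "g1 \<in> S2"
    unfolding irreducible_intersections_def by blast
  have largest: "F \<notin> T" "\<And>y. F < y \<Longrightarrow> y \<in> T"
    if "T \<in> irreducibles_with_frobenius F" for T F
    using that frobenius_number_largest_gap[of T F]
    by (auto simp: irreducibles_with_frobenius_def irreducible_semigroup_def)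
  note S1g = largest[OF S1] and S2g = largest[OF S2]
  have gaps: "g1 \<notin> S" "g2 \<notin> S"
    using S1g(1) S2g(1) eq by auto
  have above: "y \<in> S" if "g2 < y" for y
    using that S1g(2) S2g(2) \<open>g1 < g2\<close> eq by simp
  have "g2 \<in> special_gaps S"
    using largest_gap_special[OF S gaps(2) above] .
  moreover have "g1 \<in> special_gaps S"
  proof -
    have "g2 < 2 * g1"
      using assms(4) by linarith
    moreover have "g1 + s \<in> S" if "s \<in> S - {0}" for s
    proof -
      have "g1 + s \<in> S1"
        using S1g(2) that by simp
      moreover have "g1 + s \<in> S2"
        using S2 \<open>g1 \<in> S2\<close> that eq
        by (auto simp: irreducibles_with_frobenius_iff numerical_semigroup_def)
      ultimately show ?thesis
        using eq by simp
    qed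
    ultimately show ?thesis
      using gaps above by (simp add: special_gaps_def)
  qed
  moreover have "x \<in> {g1, g2}" if x: "x \<in> special_gaps S" for x
  proof (rule ccontr)
    assume other: "x \<notin> {g1, g2}"
    note ins = numerical_semigroup_insert_special_gap[OF S x]
    obtain T1 where T1: "T1 \<in> irreducibles_with_frobenius g1" "insert x S \<subseteq> T1"
      using ex_irreducible_superset[OF ins, of g1] gaps other by auto
    obtain T2 where T2: "T2 \<in> irreducibles_with_frobenius g2" "insert x S \<subseteq> T2"
      using ex_irreducible_superset[OF ins, of g2] gaps other by auto
    have "g1 \<in> T2"
      using asm T2 by blast
    then have "T1 \<inter> T2 \<in> irreducible_intersections g1 g2"
      using T1 T2 unfolding irreducible_intersections_def by blast
    moreover have "S \<subseteq> T1 \<inter> T2"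
      using T1 T2 by auto
    ultimately have "T1 \<inter> T2 = S"
      using asm by simp
    then have "x \<in> S"
      using T1 T2 by blast
    then show False
      using x by (simp add: special_gaps_def)
  qed
  ultimately show ?E
    by blast
qed

end
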